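(* Let $t_1,t_2,t_3\in\mathbb{R}$ be such that the operator $$\rho=\frac14\Big[\mathbb{I}_2\otimes\mathbb{I}_2+\sum_{i=1}^{3}t_i\,(\sigma_i\otimes\sigma_i)\Big]$$ on $\mathbb{C}^2\otimes\mathbb{C}^2$ is a density operator (a two-qubit Weyl state). Then $\rho$ is $F_3$ steerable if and only if its conditional Tsallis 2-entropy is negative, i.e. $S^T_2(A|B)_\rho<0$.
   Context: $\sigma_1,\sigma_2,\sigma_3$ are the Pauli matrices and $\vec\sigma=(\sigma_1,\sigma_2,\sigma_3)$. A density operator is a positive semidefinite operator of unit trace. The first tensor factor is system $A$ and the second is system $B$. $F_3$ steerability (violation of the three-settings CJWR steering inequality): for unit vectors $\hat u_1,\hat u_2,\hat u_3\in\mathbb{R}^3$ and orthonormal vectors $\hat v_1,\hat v_2,\hat v_3\in\mathbb{R}^3$, write $\nu=\{\hat u_1,\hat u_2,\hat u_3,\hat v_1,\hat v_2,\hat v_3\}$, $A_l=\hat u_l\cdot\vec\sigma$, $B_l=\hat v_l\cdot\vec\sigma$, and $$F_3(\rho,\nu)=\frac{1}{\sqrt3}\Big|\sum_{l=1}^{3}\mathrm{Tr}\big(\rho\,(A_l\otimes B_l)\big)\Big|.$$ The CJWR inequality is $F_3(\rho,\nu)\le 1$. The state $\rho$ is called $F_3$ steerable if $F_3(\rho,\nu)>1$ for some choice of such $\nu$, and $F_3$ unsteerable otherwise. Conditional Tsallis $\alpha$-entropy ($\alpha>0$, $\alpha\ne1$): $$S^T_\alpha(A|B)_\rho=\frac{\mathrm{Tr}(\rho_B^\alpha)-\mathrm{Tr}(\rho^\alpha)}{(\alpha-1)\,\mathrm{Tr}(\rho_B^\alpha)},\qquad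 \rho_B=\mathrm{Tr}_A\rho;$$ here $\alpha=2$. *)

theory Defs
  imports "HOL-Analysis.Analysis"
begin

definition ctranspose :: "complex^'n^'m \<Rightarrow> complex^'m^'n" where
  "ctranspose A = (\<chi> i j. cnj (A $ j $ i))"

definition cinner :: "complex^'n \<Rightarrow> complex^'n \<Rightarrow> complex" where
  "cinner x y = (\<Sum>i\<in>UNIV. cnj (x $ i) * y $ i)"

definition psd :: "complex^'n^'n \<Rightarrow> bool" where
  "psd A \<longleftrightarrow> ctranspose A = A \<and> (\<forall>x. 0 \<le> Re (cinner x (A *v x)))"

definition density_operator :: "complex^'n^'n \<Rightarrow> bool" where
  "density_operator \<rho> \<longleftrightarrow> psd \<rho> \<and> trace \<rho> = 1"

definition unitary :: "complex^'n^'n \<Rightarrow> bool" where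
  "unitary U \<longleftrightarrow> ctranspose U ** U = mat 1 \<and> U ** ctranspose U = mat 1"

definition diag_mat :: "('n \<Rightarrow> real) \<Rightarrow> complex^'n^'n" where
  "diag_mat d = (\<chi> i j. if i = j then of_real (d i) else 0)"

text \<open>Real powers of a positive semidefinite matrix, by functional calculus. The result does not
  depend on the chosen diagonalization. As \<open>0 powr a = 0\<close>, the kernel does not contribute.\<close>

definition psd_powr :: "complex^'n^'n \<Rightarrow> real \<Rightarrow> complex^'n^'n" where
  "psd_powr A a = (THE B. \<exists>U d. unitary U \<and> (\<forall>i. 0 \<le> d i)
      \<and> A = U ** diag_mat d ** ctranspose U
      \<and> B = U ** diag_mat (\<lambda>i. d i powr a) ** ctranspose U)"

lemma psd_powr_2:
  assumes U: "unitary U" and d: "\<forall>i. 0 \<le> d i" and A: "A = U ** diag_mat d ** ctranspose U"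
  shows "psd_powr A 2 = A ** A"
proof -
  have sq: "A' ** A' = V ** diag_mat (\<lambda>i. e i powr 2) ** ctranspose V"
    if V: "unitary V" and e: "\<forall>i. 0 \<le> e i" and A': "A' = V ** diag_mat e ** ctranspose V"
    for V :: "complex^'a^'a" and e A'
  proof -
    have dd: "diag_mat e ** diag_mat e = diag_mat (\<lambda>i. e i powr 2)"
    proof -
      have "(if i = k then of_real (e i) else 0) * (if k = j then of_real (e k) else 0)
          = (if k = i then (if i = j then of_real (e i * e i) else 0) else (0::complex))" for i j k
        by auto
      then show ?thesis
        using e by (simp add: diag_mat_def matrix_matrix_mult_def vec_eq_iff power2_eq_square)
    qed
    have "A' ** A' = V ** diag_mat e ** (ctranspose V ** V) ** diag_mat e ** ctranspose V"
      by (simp add: A' matrix_mul_assoc)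
    also have "\<dots> = V ** (diag_mat e ** diag_mat e) ** ctranspose V"
      using V by (simp add: unitary_def matrix_mul_assoc)
    finally show ?thesis by (simp add: dd)
  qed
  show ?thesis
    unfolding psd_powr_def
  proof (rule the_equality)
    show "\<exists>U d. unitary U \<and> (\<forall>i. 0 \<le> d i) \<and> A = U ** diag_mat d ** ctranspose U
        \<and> A ** A = U ** diag_mat (\<lambda>i. d i powr 2) ** ctranspose U"
      using sq[OF U d A] U d A by blast
  qed (use sq in auto)
qed

text \<open>The tensor product acts on the product index type, first factor \<open>A\<close>, second factor \<open>B\<close>.\<close>

definition tensor :: "complex^'a^'a \<Rightarrow> complex^'b^'b \<Rightarrow> complex^('a::finite \<times> 'b::finite)^('a \<times> 'b)"
    (infixr "\<otimes>" 75) where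
  "A \<otimes> B = (\<chi> p q. A $ fst p $ fst q * B $ snd p $ snd q)"

definition ptrace_A :: "complex^('a::finite \<times> 'b::finite)^('a \<times> 'b) \<Rightarrow> complex^'b^'b" where
  "ptrace_A \<rho> = (\<chi> k l. \<Sum>i\<in>UNIV. \<rho> $ (i, k) $ (i, l))"

definition cond_tsallis_entropy :: "real \<Rightarrow> complex^('a::finite \<times> 'b::finite)^('a \<times> 'b) \<Rightarrow> real" where
  "cond_tsallis_entropy a \<rho> =
    (Re (trace (psd_powr (ptrace_A \<rho>) a)) - Re (trace (psd_powr \<rho> a)))
      / ((a - 1) * Re (trace (psd_powr (ptrace_A \<rho>) a)))"

definition pauli :: "3 \<Rightarrow> complex^2^2" where
  "pauli i =
    (if i = 1 then vector [vector [0, 1], vector [1, 0]]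
     else if i = 2 then vector [vector [0, - \<i>], vector [\<i>, 0]]
     else vector [vector [1, 0], vector [0, - 1]])"

definition pauli_vec :: "real^3 \<Rightarrow> complex^2^2" where
  "pauli_vec u = (\<Sum>i\<in>UNIV. (u $ i) *\<^sub>R pauli i)"

definition F3 :: "complex^(2 \<times> 2)^(2 \<times> 2) \<Rightarrow> (3 \<Rightarrow> real^3) \<Rightarrow> (3 \<Rightarrow> real^3) \<Rightarrow> real" where
  "F3 \<rho> u v = 1 / sqrt 3 * cmod (\<Sum>l\<in>UNIV. trace (\<rho> ** (pauli_vec (u l) \<otimes> pauli_vec (v l))))"

definition F3_steerable :: "complex^(2 \<times> 2)^(2 \<times> 2) \<Rightarrow> bool" where
  "F3_steerable \<rho> \<longleftrightarrow> (\<exists>u v. (\<forall>l. norm (u l) = 1) \<and>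
      (\<forall>l. norm (v l) = 1) \<and> (\<forall>l m. l \<noteq> m \<longrightarrow> v l \<bullet> v m = 0) \<and> F3 \<rho> u v > 1)"

end

(* With T = diag(t), the correlation sum is the sum over l of u_l . (T v_l). Cauchy-Schwarz and
   the basis independence of sum |T v_l|^2 bound F_3 by |t|; equality holds for an orthonormal basis
   on which all |T v_l| agree, with u_l parallel to T v_l. So rho is steerable iff |t|^2 > 1.
   On the other side Tr rho^2 = (1 + |t|^2) / 4 and Tr rho_B^2 = 1 / 2, so the entropy
   equals (1 - |t|^2) / 2. *)

theory Submission
  imports Defs
begin

lemma sum_2x2: "sum f (UNIV :: (2 \<times> 2) set) = f (1, 1) + f (1, 2) + f (2, 1) + f (2, 2)"
  by (simp add: UNIV_Times_UNIV[symmetric] sum.cartesian_product[symmetric] UNIV_2 add.assoc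
      del: UNIV_Times_UNIV)

lemma forall_2x2: "(\<forall>p :: 2 \<times> 2. P p) \<longleftrightarrow> P (1, 1) \<and> P (1, 2) \<and> P (2, 1) \<and> P (2, 2)"
  by (simp add: split_paired_all forall_2)

definition weyl :: "(3 \<Rightarrow> real) \<Rightarrow> complex^(2 \<times> 2)^(2 \<times> 2)" where
  "weyl t = (1 / 4) *\<^sub>R ((mat 1 :: complex^2^2) \<otimes> (mat 1 :: complex^2^2)
     + (\<Sum>i\<in>UNIV. t i *\<^sub>R (pauli i \<otimes> pauli i)))"

lemma pauli_nth:
  "pauli 1 $ a $ b = (if a = b then 0 else 1)"
  "pauli 2 $ a $ b = (if a = b then 0 else if a = 1 then - \<i> else \<i>)"
  "pauli 3 $ a $ b = (if a \<noteq> b then 0 else if a = 1 then 1 else - 1)"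
  using exhaust_2[of a] exhaust_2[of b] by (auto simp: pauli_def)

lemma weyl_nth:
  "weyl t $ (a, b) $ (c, d) =
    (if a = c \<and> b = d then of_real (1 + (if a = b then t 3 else - t 3)) / 4
     else if a \<noteq> c \<and> b \<noteq> d then of_real (t 1 + (if a = b then - t 2 else t 2)) / 4
     else 0)"
  using exhaust_2[of a] exhaust_2[of b] exhaust_2[of c] exhaust_2[of d]
  by (elim disjE) (simp_all add: weyl_def tensor_def sum_3 pauli_nth mat_def complex_eq_iff)

text \<open>The Pauli matrices are traceless and Tr(\<open>pauli i\<close> \<open>pauli j\<close>)
  is 2 for i = j and 0 otherwise, so only matching pairs survive, and the resulting factor 4 cancels
  the normalisation 1/4.\<close>

lemma trace_weyl_pauli_vec:
  "trace (weyl t ** (pauli_vec u \<otimes> pauli_vec v)) = of_real (\<Sum>i\<in>UNIV. t i * u $ i * v $ i)"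
  by (simp add: trace_def matrix_matrix_mult_def sum_2x2 weyl_nth tensor_def pauli_vec_def
      sum_3 pauli_nth complex_eq_iff field_simps)

lemma trace_weyl_square: "trace (weyl t ** weyl t) = of_real ((1 + (\<Sum>i\<in>UNIV. (t i)\<^sup>2)) / 4)"
  by (simp add: trace_def matrix_matrix_mult_def sum_2x2 weyl_nth
      sum_3 complex_eq_iff field_simps power2_eq_square)

lemma ptrace_A_weyl: "ptrace_A (weyl t) = diag_mat (\<lambda>_. 1 / 2)"
  by (simp add: ptrace_A_def diag_mat_def vec_eq_iff forall_2 sum_2 weyl_nth complex_eq_iff
      add_divide_distrib diff_divide_distrib)

text \<open>The Bell basis in columns: \<open>(1, s)\<close> is the column \<open>(|00> \<plusminus> |11>) / \<surd>2\<close> and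
  \<open>(2, s)\<close> is \<open>(|01> \<plusminus> |10>) / \<surd>2\<close>, with the sign \<open>-\<close> for \<open>s = 2\<close>.\<close>

definition bell :: "complex^(2 \<times> 2)^(2 \<times> 2)" where
  "bell = (\<chi> p q. if (fst p = snd p) = (fst q = 1)
     then of_real ((if fst p = 2 \<and> snd q = 2 then - 1 else 1) / sqrt 2) else 0)"

definition weyl_eigenvalue :: "(3 \<Rightarrow> real) \<Rightarrow> 2 \<times> 2 \<Rightarrow> real" where
  "weyl_eigenvalue t q =
    (let s = (if snd q = 1 then 1 else - 1) in
      if fst q = 1 then (1 + s * t 1 - s * t 2 + t 3) / 4 else (1 + s * t 1 + s * t 2 - t 3) / 4)"

lemma unitary_bell: "unitary bell"
  by (simp add: unitary_def ctranspose_def bell_def matrix_matrix_mult_def mat_def vec_eq_iff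
      forall_2x2 sum_2x2 complex_eq_iff del: split_paired_All)

text \<open>Every \<open>pauli i \<otimes> pauli i\<close> is diagonal in the Bell basis with
  eigenvalues 1 and -1. This supplies the diagonalization that \<open>psd_powr_2\<close> asks
  for.\<close>

lemma weyl_bell: "weyl t = bell ** diag_mat (weyl_eigenvalue t) ** ctranspose bell"
proof -
  have sqrt2: "sqrt 2 * (sqrt 2 * x) = 2 * x" for x
    by (simp flip: mult.assoc)
  show ?thesis
    by (simp add: ctranspose_def bell_def matrix_matrix_mult_def diag_mat_def vec_eq_iff
        forall_2x2 sum_2x2 complex_eq_iff weyl_nth weyl_eigenvalue_def field_simps
        sqrt2 del: split_paired_All)
qed

text \<open>Column \<open>i\<close> of \<open>U\<close> is a unit eigenvector for
  \<open>d i\<close>, so the quadratic form takes the value \<open>d i\<close> there.\<close>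

lemma psd_diagonalization_nonneg:
  assumes "psd (U ** diag_mat d ** ctranspose U)" "unitary U"
  shows "0 \<le> d i"
proof -
  define x where "x = U *v axis i 1"
  have "ctranspose U *v x = axis i 1"
    using assms(2) by (simp add: x_def unitary_def matrix_vector_mul_assoc)
  then have "(U ** diag_mat d ** ctranspose U) *v x = U *v (diag_mat d *v axis i 1)"
    by (simp add: matrix_vector_mul_assoc[symmetric])
  also have "diag_mat d *v axis i 1 = d i *\<^sub>R axis i 1"
    by (auto simp: vec_eq_iff diag_mat_def matrix_vector_mult_def axis_def complex_eq_iff
        if_distrib[of "\<lambda>x. _ * x"] cong: if_cong)
  also have "U *v (d i *\<^sub>R axis i 1) = d i *\<^sub>R x"
    by (simp add: vec_eq_iff matrix_vector_mult_def x_def scaleR_sum_right)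
  finally have "Re (cinner x ((U ** diag_mat d ** ctranspose U) *v x)) = d i * Re (cinner x x)"
    by (simp add: cinner_def scaleR_sum_right[symmetric] sum_distrib_left algebra_simps)
  moreover have "cinner x x = (ctranspose U ** U) $ i $ i"
    by (simp add: cinner_def ctranspose_def x_def matrix_matrix_mult_def
        matrix_vector_mult_def axis_def if_distrib cong: if_cong)
  then have "cinner x x = 1"
    using assms(2) by (simp add: unitary_def mat_def)
  ultimately show ?thesis
    using assms(1) by (metis psd_def mult.right_neutral one_complex.sel(1))
qed

text \<open>Both powers reduce to ordinary matrix squares: the state is diagonalized by the Bell
  basis, and its marginal, being maximally mixed, by the identity.\<close>

lemma cond_tsallis_entropy_weyl:
  assumes "psd (weyl t)"
  shows "cond_tsallis_entropy 2 (weyl t) = (1 - (\<Sum>i\<in>UNIV. (t i)\<^sup>2)) / 2"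
proof -
  have sq: "psd_powr (weyl t) 2 = weyl t ** weyl t"
    using psd_diagonalization_nonneg[of bell "weyl_eigenvalue t"] assms
    by (intro psd_powr_2[OF unitary_bell _ weyl_bell]) (simp add: weyl_bell[symmetric] unitary_bell)
  have sq_B: "psd_powr (ptrace_A (weyl t)) 2 = ptrace_A (weyl t) ** ptrace_A (weyl t)"
    by (rule psd_powr_2[of "mat 1" "\<lambda>_. 1 / 2"])
      (simp_all add: unitary_def ptrace_A_weyl ctranspose_def mat_def vec_eq_iff
        matrix_matrix_mult_def forall_2 sum_2)
  have "Re (trace (ptrace_A (weyl t) ** ptrace_A (weyl t))) = 1 / 2"
    by (simp add: ptrace_A_weyl trace_def matrix_matrix_mult_def diag_mat_def sum_2)
  then show ?thesis
    unfolding cond_tsallis_entropy_def sq sq_B trace_weyl_square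
    by (simp only:) (simp add: field_simps)
qed

definition corr :: "(3 \<Rightarrow> real) \<Rightarrow> real^3 \<Rightarrow> real^3" where
  "corr t v = (\<chi> i. t i * v $ i)"

lemma F3_weyl: "F3 (weyl t) u v = \<bar>\<Sum>l\<in>UNIV. u l \<bullet> corr t (v l)\<bar> / sqrt 3"
proof -
  have "(\<Sum>l\<in>UNIV. trace (weyl t ** (pauli_vec (u l) \<otimes> pauli_vec (v l))))
      = of_real (\<Sum>l\<in>UNIV. u l \<bullet> corr t (v l))"
    by (simp add: trace_weyl_pauli_vec inner_vec_def corr_def algebra_simps)
  then show ?thesis
    by (simp only: F3_def norm_of_real) simp
qed

lemma orthonormal_matrix:
  fixes v :: "'n::finite \<Rightarrow> real^'n"
  assumes "\<forall>l. norm (v l) = 1" "\<forall>l m. l \<noteq> m \<longrightarrow> v l \<bullet> v m = 0"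
  shows "orthogonal_matrix (\<chi> l. v l)"
  using assms by (simp add: orthogonal_matrix_orthonormal_rows row_def pairwise_def
      orthogonal_def rows_def)

text \<open>Both sides are the squared Hilbert-Schmidt norm of diag(t). An orthogonal matrix with
  rows \<open>v l\<close> also has unit columns, so each \<open>(t i)\<^sup>2\<close> gets total
  weight 1.\<close>

lemma sum_norm_corr:
  fixes v :: "3 \<Rightarrow> real^3"
  assumes "\<forall>l. norm (v l) = 1" "\<forall>l m. l \<noteq> m \<longrightarrow> v l \<bullet> v m = 0"
  shows "(\<Sum>l\<in>UNIV. (norm (corr t (v l)))\<^sup>2) = (\<Sum>i\<in>UNIV. (t i)\<^sup>2)"
proof -
  have col: "(\<Sum>l\<in>UNIV. (v l $ i)\<^sup>2) = 1" for i
  proof -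
    have "(transpose (\<chi> l. v l) ** (\<chi> l. v l)) $ i $ i = (1 :: real)"
      using orthonormal_matrix[OF assms] by (simp add: orthogonal_matrix mat_def)
    then show ?thesis
      by (simp add: transpose_def matrix_matrix_mult_def power2_eq_square)
  qed
  have "(\<Sum>l\<in>UNIV. (norm (corr t (v l)))\<^sup>2) = (\<Sum>l\<in>UNIV. \<Sum>i\<in>UNIV. (t i)\<^sup>2 * (v l $ i)\<^sup>2)"
    by (simp add: power2_norm_eq_inner inner_vec_def corr_def flip: power_mult_distrib)
      (simp add: power2_eq_square)
  also have "\<dots> = (\<Sum>i\<in>UNIV. (t i)\<^sup>2 * (\<Sum>l\<in>UNIV. (v l $ i)\<^sup>2))"
    by (subst sum.swap) (simp add: sum_distrib_left)
  finally show ?thesis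
    by (simp add: col)
qed

lemma F3_weyl_le:
  assumes u: "\<forall>l. norm (u l) = 1"
    and v: "\<forall>l. norm (v l) = 1" "\<forall>l m. l \<noteq> m \<longrightarrow> v l \<bullet> v m = 0"
  shows "F3 (weyl t) u v \<le> sqrt (\<Sum>i\<in>UNIV. (t i)\<^sup>2)"
proof -
  have "\<bar>\<Sum>l\<in>UNIV. u l \<bullet> corr t (v l)\<bar> \<le> (\<Sum>l\<in>UNIV. \<bar>u l \<bullet> corr t (v l)\<bar>)"
    by (rule sum_abs)
  \<comment> \<open>The factor 1 prepares a second Cauchy-Schwarz, over \<open>l\<close>; the
    constant vector has norm \<open>sqrt 3\<close>, which cancels the prefactor of
    \<open>F3\<close>.\<close>
  also have "\<dots> \<le> (\<Sum>l\<in>UNIV. \<bar>1\<bar> * \<bar>norm (corr t (v l))\<bar>)"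
    by (rule sum_mono) (metis Cauchy_Schwarz_ineq2 abs_norm_cancel abs_one u)
  also have "\<dots> \<le> L2_set (\<lambda>_. 1) (UNIV :: 3 set) * L2_set (\<lambda>l. norm (corr t (v l))) UNIV"
    by (rule L2_set_mult_ineq)
  also have "\<dots> = sqrt 3 * sqrt (\<Sum>i\<in>UNIV. (t i)\<^sup>2)"
    using sum_norm_corr[OF v] by (simp add: L2_set_def)
  finally show ?thesis
    by (simp add: F3_weyl field_simps)
qed

text \<open>The first vector is \<open>(1, 1, 1) / \<surd>3\<close>. Rotating an orthonormal pair in its
  orthogonal complement by a right angle exchanges the excesses of \<open>|T v|\<^sup>2\<close> over the mean in the
  two directions, so the intermediate value theorem gives an angle where both vanish.\<close>

lemma ex_orthonormal_equal_norm_corr: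
  obtains v :: "3 \<Rightarrow> real^3"
  where "\<forall>l. norm (v l) = 1" "\<forall>l m. l \<noteq> m \<longrightarrow> v l \<bullet> v m = 0"
    "\<forall>l. (norm (corr t (v l)))\<^sup>2 = (\<Sum>i\<in>UNIV. (t i)\<^sup>2) / 3"
proof -
  define m where "m = (\<Sum>i\<in>UNIV. (t i)\<^sup>2) / 3"
  define n :: "real^3" where "n = vector [1 / sqrt 3, 1 / sqrt 3, 1 / sqrt 3]"
  define e :: "real^3" where "e = vector [1 / sqrt 2, - 1 / sqrt 2, 0]"
  define f :: "real^3" where "f = vector [1 / sqrt 6, 1 / sqrt 6, - 2 / sqrt 6]"
  define w where "w x = cos x *\<^sub>R e + sin x *\<^sub>R f" for x
  define w' where "w' x = cos x *\<^sub>R f - sin x *\<^sub>R e" for x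
  have ip: "n \<bullet> n = 1" "e \<bullet> e = 1" "f \<bullet> f = 1" "n \<bullet> e = 0" "n \<bullet> f = 0" "e \<bullet> f = 0"
    by (simp_all add: n_def e_def f_def inner_vec_def sum_3)
  have frame: "n \<bullet> w x = 0" "n \<bullet> w' x = 0" "w x \<bullet> w' x = 0" "w x \<bullet> w x = 1" "w' x \<bullet> w' x = 1"
    for x
    using sin_cos_squared_add3[of x]
    by (simp_all add: w_def w'_def ip inner_commute[of f e] inner_simps algebra_simps)
  define v :: "real \<Rightarrow> 3 \<Rightarrow> real^3"
    where "v x l = (if l = 1 then n else if l = 2 then w x else w' x)" for x l
  have unit: "\<forall>l. norm (v x l) = 1" for x
    by (simp add: v_def norm_eq_1 frame ip)
  have orth: "\<forall>l m. l \<noteq> m \<longrightarrow> v x l \<bullet> v x m = 0" for x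
    using frame[of x] by (auto simp: v_def forall_3 inner_commute)
  \<comment> \<open>All squared coordinates of \<open>n\<close> are 1/3, so \<open>n\<close> attains
    the mean and the other two vectors share the remaining \<open>2 * m\<close>.\<close>
  have n_mean: "(norm (corr t n))\<^sup>2 = m"
    by (simp add: power2_norm_eq_inner corr_def n_def m_def inner_vec_def sum_3)
      (simp add: power2_eq_square field_simps)
  have pair: "(norm (corr t (w x)))\<^sup>2 + (norm (corr t (w' x)))\<^sup>2 = 2 * m" for x
    using sum_norm_corr[OF unit orth, of t x] n_mean
    unfolding m_def sum_3[of "\<lambda>l. (norm (corr t (v x l)))\<^sup>2"] by (simp add: v_def)
  define g where "g x = (norm (corr t (w x)))\<^sup>2" for x
  \<comment> \<open>A right angle turns \<open>w\<close> into \<open>w'\<close>: both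
    \<open>w' 0\<close> and \<open>w (pi / 2)\<close> are \<open>f\<close>. Hence \<open>m\<close>
    lies between the two values of \<open>g\<close>, and the cases below only settle their
    order.\<close>
  have sum_g: "g 0 + g (pi / 2) = 2 * m"
    using pair[of 0] by (simp add: g_def w_def w'_def)
  have cont: "continuous_on {0..pi / 2} g"
    unfolding g_def w_def corr_def by (intro continuous_intros)
  have "\<exists>x. 0 \<le> x \<and> x \<le> pi / 2 \<and> g x = m"
  proof (cases "g 0 \<le> m")
    case True
    then show ?thesis
      using sum_g by (intro IVT'[OF _ _ _ cont]) simp_all
  next
    case False
    then show ?thesis
      using sum_g by (intro IVT2'[OF _ _ _ cont]) simp_all
  qed
  then obtain x where "g x = m"
    by blast
  then have "\<forall>l. (norm (corr t (v x l)))\<^sup>2 = m"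
    using pair[of x] n_mean by (simp add: v_def g_def)
  then show ?thesis
    using that[of "v x"] unit orth unfolding m_def by blast
qed

lemma F3_steerable_weyl: "F3_steerable (weyl t) \<longleftrightarrow> (\<Sum>i\<in>UNIV. (t i)\<^sup>2) > 1"
proof
  assume "F3_steerable (weyl t)"
  then obtain u v where "\<forall>l. norm (u l) = 1" "\<forall>l. norm (v l) = 1"
    "\<forall>l m. l \<noteq> m \<longrightarrow> v l \<bullet> v m = 0" "F3 (weyl t) u v > 1"
    unfolding F3_steerable_def by blast
  then have "sqrt (\<Sum>i\<in>UNIV. (t i)\<^sup>2) > 1"
    using F3_weyl_le by (meson less_le_trans)
  then show "(\<Sum>i\<in>UNIV. (t i)\<^sup>2) > 1"
    by simp
next
  assume gt: "(\<Sum>i\<in>UNIV. (t i)\<^sup>2) > 1"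
  obtain v :: "3 \<Rightarrow> real^3" where v: "\<forall>l. norm (v l) = 1"
    "\<forall>l m. l \<noteq> m \<longrightarrow> v l \<bullet> v m = 0"
    "\<forall>l. (norm (corr t (v l)))\<^sup>2 = (\<Sum>i\<in>UNIV. (t i)\<^sup>2) / 3"
    by (rule ex_orthonormal_equal_norm_corr)
  define r where "r = sqrt ((\<Sum>i\<in>UNIV. (t i)\<^sup>2) / 3)"
  have r: "norm (corr t (v l)) = r" for l
    using v(3) by (metis r_def norm_ge_zero real_sqrt_unique)
  have "r > 0"
    using gt by (simp add: r_def)
  \<comment> \<open>Equality in the first Cauchy-Schwarz comes from parallel vectors, in the second
    from the common length \<open>r\<close>.\<close>
  define u where "u l = corr t (v l) /\<^sub>R r" for l
  have u: "\<forall>l. norm (u l) = 1"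
    using \<open>r > 0\<close> by (simp add: u_def r)
  have "u l \<bullet> corr t (v l) = r" for l
    using \<open>r > 0\<close> by (simp add: u_def r power2_norm_eq_inner[symmetric] power2_eq_square)
  then have "F3 (weyl t) u v = 3 * r / sqrt 3"
    using \<open>r > 0\<close> by (simp add: F3_weyl)
  also have "\<dots> = sqrt (\<Sum>i\<in>UNIV. (t i)\<^sup>2)"
    by (simp add: r_def real_sqrt_divide)
  also have "\<dots> > 1"
    using gt by simp
  finally show "F3_steerable (weyl t)"
    unfolding F3_steerable_def using u v by blast
qed

theorem mainTheorem2:
  fixes t :: "3 \<Rightarrow> real" and \<rho> :: "complex^(2 \<times> 2)^(2 \<times> 2)"
  assumes "\<rho> = (1 / 4) *\<^sub>R ((mat 1 :: complex^2^2) \<otimes> (mat 1 :: complex^2^2)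
                  + (\<Sum>i\<in>UNIV. t i *\<^sub>R (pauli i \<otimes> pauli i)))"
    and "density_operator \<rho>"
  shows "F3_steerable \<rho> \<longleftrightarrow> cond_tsallis_entropy 2 \<rho> < 0"
proof -
  have \<rho>: "\<rho> = weyl t"
    using assms(1) by (simp add: weyl_def)
  then have "cond_tsallis_entropy 2 (weyl t) = (1 - (\<Sum>i\<in>UNIV. (t i)\<^sup>2)) / 2"
    using assms(2) by (simp add: density_operator_def cond_tsallis_entropy_weyl)
  then show ?thesis
    unfolding \<rho> F3_steerable_weyl by auto
qed

end
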